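(* Let $V$ be a vector space of finite dimension $n$ over a field of characteristic $0$ and let $X$ be a linear operator on $V$. For $j\ge 1$ let $X^{[j]}:=\mathrm{Tr}_{(1\dots j-1)}(\Lambda^jX)$ (an operator on $V$), let $\sigma_j(X):=\mathrm{Tr}_{\Lambda^jV}(\Lambda^jX)$, and put $\sigma_0(X):=1$. Then for all integers $k\ge 1$ $$k\,X^{[k]}=-\sum_{j=0}^{k-1}(-X)^{k-j}\,\sigma_j(X).$$
   Context: The space $\Lambda^kV$ is identified with the image in $V^{\otimes k}$ of the antisymmetrizer $A_k$, with matrix elements $(A_k)^{i_1\dots i_k}_{j_1\dots j_k}=\frac1{k!}\delta^{i_1}_{[j_1}\cdots\delta^{i_k}_{j_k]}$, where $[\dots]$ denotes the signed sum over all permutations of the indices $j_1,\dots,j_k$. The operator $\Lambda^kX$ is regarded as the operator $A_k\,(X\otimes\cdots\otimes X)$ on $V^{\otimes k}$: it acts on $\Lambda^kV$ by $v_1\wedge\dots\wedge v_k\mapsto Xv_1\wedge\dots\wedge Xv_k$ and by zero on the complement $\ker A_k$. $\mathrm{Tr}_{(1\dots j-1)}$ is the partial trace over the first $j-1$ tensor factors of $V^{\otimes j}$, so its value is an operator on the last factor $V$; for $j=1$ no trace is taken and $X^{[1]}=X$. *)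

theory Defs
  imports Complex_Main "HOL-Combinatorics.Permutations" "HOL-Library.Function_Algebras"
begin

text \<open>
  \<open>V\<close> is the type \<open>'v\<close> with scalar multiplication \<open>scale\<close>, and \<open>B\<close> is a finite basis of it.
  A tensor in the \<open>k\<close>-th tensor power of \<open>V\<close> is the family of its components
  \<open>t [i1, ..., ik]\<close>, where each index is a vector of \<open>B\<close>; components outside the index range
  are \<open>0\<close>.  A linear operator on the tensor power is given by its matrix elements \<open>M I J\<close>,
  with upper multi-index \<open>I\<close> (row) and lower multi-index \<open>J\<close> (column).
\<close>

type_synonym ('v, 'a) tensor = "'v list \<Rightarrow> 'a"
type_synonym ('v, 'a) tensor_op = "'v list \<Rightarrow> 'v list \<Rightarrow> 'a"

definition multi_indices :: "'v set \<Rightarrow> nat \<Rightarrow> 'v list set" where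
  "multi_indices B k = {I. length I = k \<and> set I \<subseteq> B}"

definition tensor_space :: "'v set \<Rightarrow> nat \<Rightarrow> ('v, 'a::zero) tensor set" where
  "tensor_space B k = {t. \<forall>I. I \<notin> multi_indices B k \<longrightarrow> t I = 0}"

definition tensor_scale :: "'a::times \<Rightarrow> ('v, 'a) tensor \<Rightarrow> ('v, 'a) tensor" where
  "tensor_scale c t = (\<lambda>I. c * t I)"

definition tensor_apply ::
    "'v set \<Rightarrow> nat \<Rightarrow> ('v, 'a::comm_ring_1) tensor_op \<Rightarrow> ('v, 'a) tensor \<Rightarrow> ('v, 'a) tensor" where
  "tensor_apply B k M t =
     (\<lambda>I. if I \<in> multi_indices B k then \<Sum>J\<in>multi_indices B k. M I J * t J else 0)"

definition tensor_comp ::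
    "'v set \<Rightarrow> nat \<Rightarrow> ('v, 'a::comm_ring_1) tensor_op \<Rightarrow> ('v, 'a) tensor_op \<Rightarrow> ('v, 'a) tensor_op" where
  "tensor_comp B k M N = (\<lambda>I J. \<Sum>K\<in>multi_indices B k. M I K * N K J)"

definition antisymmetrizer :: "nat \<Rightarrow> ('v, 'a::field_char_0) tensor_op" where
  "antisymmetrizer k = (\<lambda>I J. 1 / fact k *
     (\<Sum>p | p permutes {..<k}. of_int (sign p) * (\<Prod>s<k. if I ! s = J ! p s then 1 else 0)))"

definition exterior_space :: "'v set \<Rightarrow> nat \<Rightarrow> ('v, 'a::field_char_0) tensor set" where
  "exterior_space B k = tensor_apply B k (antisymmetrizer k) ` tensor_space B k"

definition matrix_element ::
    "('a::field \<Rightarrow> 'v::ab_group_add \<Rightarrow> 'v) \<Rightarrow> 'v set \<Rightarrow> ('v \<Rightarrow> 'v) \<Rightarrow> 'v \<Rightarrow> 'v \<Rightarrow> 'a" where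
  "matrix_element scale B X i j = module.representation scale B (X j) i"

text \<open>The operator \<open>X \<otimes> \<dots> \<otimes> X\<close> (\<open>k\<close> factors).\<close>

definition tensor_power_op ::
    "('a::field \<Rightarrow> 'v::ab_group_add \<Rightarrow> 'v) \<Rightarrow> 'v set \<Rightarrow> ('v \<Rightarrow> 'v) \<Rightarrow> nat \<Rightarrow> ('v, 'a) tensor_op" where
  "tensor_power_op scale B X k = (\<lambda>I J. \<Prod>s<k. matrix_element scale B X (I ! s) (J ! s))"

definition exterior_power_op ::
    "('a::field_char_0 \<Rightarrow> 'v::ab_group_add \<Rightarrow> 'v) \<Rightarrow> 'v set \<Rightarrow> ('v \<Rightarrow> 'v) \<Rightarrow> nat \<Rightarrow> ('v, 'a) tensor_op" where
  "exterior_power_op scale B X k =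
     tensor_comp B k (antisymmetrizer k) (tensor_power_op scale B X k)"

text \<open>
  The trace over the first \<open>k - 1\<close> factors, for \<open>k \<ge> 1\<close>, is an operator on the last factor \<open>V\<close>.
  For \<open>k = 1\<close> the sum has the single term \<open>K = []\<close>, so no trace is taken.
\<close>

definition partial_trace ::
    "('a::field \<Rightarrow> 'v::ab_group_add \<Rightarrow> 'v) \<Rightarrow> 'v set \<Rightarrow> nat \<Rightarrow> ('v, 'a) tensor_op \<Rightarrow> 'v \<Rightarrow> 'v" where
  "partial_trace scale B k M v =
     (\<Sum>i\<in>B. scale (\<Sum>j\<in>B. (\<Sum>K\<in>multi_indices B (k - 1). M (K @ [i]) (K @ [j]))
                           * module.representation scale B v j) i)"

definition bracket_power ::
    "('a::field_char_0 \<Rightarrow> 'v::ab_group_add \<Rightarrow> 'v) \<Rightarrow> 'v set \<Rightarrow> ('v \<Rightarrow> 'v) \<Rightarrow> nat \<Rightarrow> 'v \<Rightarrow> 'v" where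
  "bracket_power scale B X k = partial_trace scale B k (exterior_power_op scale B X k)"

text \<open>The trace of the operator induced by \<open>T\<close> on a finite-dimensional \<open>T\<close>-invariant subspace \<open>W\<close>.\<close>

definition trace_on ::
    "('a::field \<Rightarrow> 'w::ab_group_add \<Rightarrow> 'w) \<Rightarrow> 'w set \<Rightarrow> ('w \<Rightarrow> 'w) \<Rightarrow> 'a" where
  "trace_on sc W T =
     (let C = (SOME C. \<not> module.dependent sc C \<and> module.span sc C = W)
      in \<Sum>c\<in>C. module.representation sc C (T c) c)"

definition sigma ::
    "('a::field_char_0 \<Rightarrow> 'v::ab_group_add \<Rightarrow> 'v) \<Rightarrow> 'v set \<Rightarrow> ('v \<Rightarrow> 'v) \<Rightarrow> nat \<Rightarrow> 'a" where
  "sigma scale B X j =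
     (if j = 0 then 1
      else trace_on tensor_scale (exterior_space B j)
             (tensor_apply B j (exterior_power_op scale B X j)))"

end

theory Submission
  imports Defs
begin

text \<open>
  Up to the factor \<open>k!\<close>, the matrix elements of \<open>\<Lambda>\<^sup>k X\<close> are determinants (with repeated rows and
  columns allowed).  Laplace expansion along the last column of the determinants whose sum is
  \<open>X\<^sup>[\<^sup>k\<^sup>+\<^sup>1\<^sup>]\<close> yields the recursion \<open>(k + 1) X\<^sup>[\<^sup>k\<^sup>+\<^sup>1\<^sup>] = \<sigma>\<^sub>k(X) X - k X\<^sup>[\<^sup>k\<^sup>] X\<close>, which is then solved by
  induction.  The trace \<open>\<sigma>\<^sub>k(X)\<close> over the image of the antisymmetrizer equals the trace over the
  whole tensor power: if \<open>T = A N\<close>, the trace of \<open>T\<close> on the image of \<open>A\<close> is the trace of \<open>N A\<close>.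
\<close>

section \<open>Determinants indexed by multi-indices, and Laplace expansion\<close>

definition minor :: "('v \<Rightarrow> 'v \<Rightarrow> 'a::comm_ring_1) \<Rightarrow> nat \<Rightarrow> 'v list \<Rightarrow> 'v list \<Rightarrow> 'a" where
  "minor m k I J =
     (\<Sum>p | p permutes {..<k}. of_int (sign p) * (\<Prod>s<k. m (I ! p s) (J ! s)))"

lemma finite_multi_indices [simp]:
  assumes "finite B"
  shows "finite (multi_indices B k)"
  using finite_lists_length_eq[OF assms, of k]
  by (simp add: multi_indices_def conj_commute)

lemma multi_indices_0 [simp]: "multi_indices B 0 = {[]}"
  by (auto simp: multi_indices_def)

text \<open>The last index is the one split off because both the partial trace and the Laplace
  expansion single out the last position.\<close>

lemma sum_multi_indices_Suc:
  "(\<Sum>K\<in>multi_indices B (Suc n). f K) = (\<Sum>l\<in>B. \<Sum>K\<in>multi_indices B n. f (K @ [l]))"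
proof -
  have "(\<Sum>K\<in>multi_indices B (Suc n). f K) = (\<Sum>(l, K)\<in>B \<times> multi_indices B n. f (K @ [l]))"
  proof (rule sum.reindex_bij_witness[where i = "\<lambda>(l, K). K @ [l]" and j = "\<lambda>K. (last K, butlast K)"])
    fix K assume "K \<in> multi_indices B (Suc n)"
    then have K: "length K = Suc n" "set K \<subseteq> B" by (auto simp: multi_indices_def)
    then have "K \<noteq> []" by auto
    then show "(case (last K, butlast K) of (l, K) \<Rightarrow> K @ [l]) = K" by simp
    show "(last K, butlast K) \<in> B \<times> multi_indices B n"
      using K \<open>K \<noteq> []\<close> in_set_butlastD[of _ K] by (auto simp: multi_indices_def)
    show "(case (last K, butlast K) of (l, K) \<Rightarrow> f (K @ [l])) = f K" 
      using \<open>K \<noteq> []\<close> by simp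
  qed (auto simp: multi_indices_def)
  then show ?thesis by (simp add: sum.cartesian_product)
qed

lemma permutes_lessThan_iff:
  assumes "p permutes {..<k::nat}"
  shows "p s < k \<longleftrightarrow> s < k"
  using permutes_in_image[OF assms, of s] by simp

text \<open>Reordering rows and columns by the same \<open>q\<close> conjugates the summation
  permutation by \<open>q\<close>, which preserves its sign.\<close>

lemma minor_permute:
  assumes q: "q permutes {..<k}"
    and I: "\<And>s. s < k \<Longrightarrow> I' ! s = I ! q s"
    and J: "\<And>s. s < k \<Longrightarrow> J' ! s = J ! q s"
  shows "minor m k I' J' = minor m k I J"
proof -
  have bij: "bij_betw q {..<k} {..<k}" by (rule permutes_imp_bij[OF q])
  have qi: "inv q permutes {..<k}" by (rule permutes_inv[OF q])
  have "minor m k I' J' =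
      (\<Sum>p | p permutes {..<k}. of_int (sign p) * (\<Prod>s<k. m (I ! q (p s)) (J ! q s)))"
    unfolding minor_def
    by (intro sum.cong refl arg_cong2[where f = "(*)"] prod.cong)
       (auto simp: I J permutes_lessThan_iff)
  also have "\<dots> =
      (\<Sum>p | p permutes {..<k}. of_int (sign p) * (\<Prod>s<k. m (I ! p s) (J ! s)))"
  proof (rule sum.reindex_bij_witness[where i = "\<lambda>p. inv q \<circ> p \<circ> q" and j = "\<lambda>p. q \<circ> p \<circ> inv q"])
    fix p assume "p \<in> {p. p permutes {..<k}}"
    then have p: "p permutes {..<k}" by simp
    show "inv q \<circ> (q \<circ> p \<circ> inv q) \<circ> q = p" "q \<circ> (inv q \<circ> p \<circ> q) \<circ> inv q = p"
      using permutes_inv_o[OF q] by (simp_all add: fun_eq_iff)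
    show "inv q \<circ> p \<circ> q \<in> {p. p permutes {..<k}}" "q \<circ> p \<circ> inv q \<in> {p. p permutes {..<k}}"
      using p q qi by (auto intro!: permutes_compose)
    have perm: "permutation p" "permutation q" "permutation (inv q)" "permutation (q \<circ> p)"
      using p q qi permutes_compose[OF p q] by (auto intro: permutation_permutes[THEN iffD2])
    have "sign (q \<circ> p \<circ> inv q) = sign p"
      using perm by (simp add: sign_compose sign_inverse sign_idempotent mult.assoc mult.left_commute)
    moreover have "(\<Prod>s<k. m (I ! (q \<circ> p \<circ> inv q) s) (J ! s)) = (\<Prod>s<k. m (I ! q (p s)) (J ! q s))"
      by (subst prod.reindex_bij_betw[OF bij, symmetric])
         (simp add: permutes_inverses[OF q])
    ultimately show "of_int (sign (q \<circ> p \<circ> inv q)) * (\<Prod>s<k. m (I ! (q \<circ> p \<circ> inv q) s) (J ! s)) =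
      of_int (sign p) * (\<Prod>s<k. m (I ! q (p s)) (J ! q s))"
      by simp
  qed
  finally show ?thesis by (simp add: minor_def)
qed

text \<open>The cofactors are kept as determinants over the columns \<open>K\<close>: when row
  \<open>b < n\<close> is paired with the last column, row \<open>i\<close> takes over position
  \<open>b\<close>. This exchange is a single transposition, so all these terms carry the same sign
  -1.\<close>

lemma minor_expand_last_column:
  assumes "length K = n"
  shows "minor m (Suc n) (K @ [i]) (K @ [j]) =
    minor m n K K * m i j - (\<Sum>b<n. minor m n (K[b := i]) K * m (K ! b) j)"
proof -
  let ?f = "\<lambda>p. of_int (sign p) * (\<Prod>s<Suc n. m ((K @ [i]) ! p s) ((K @ [j]) ! s))"
  \<comment> \<open>Every permutation of n + 1 positions is uniquely
    \<open>transpose n b \<circ> q\<close> with \<open>q\<close> fixing \<open>n\<close>; it sends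
    \<open>n\<close> to \<open>b\<close>, so \<open>b\<close> is the row paired with the last
    column.\<close>
  have f: "?f (transpose n b \<circ> q) =
      (if b = n then of_int (sign q) * (\<Prod>s<n. m (K ! q s) (K ! s)) * m i j
       else - (of_int (sign q) * (\<Prod>s<n. m (K[b := i] ! q s) (K ! s)) * m (K ! b) j))"
    if b: "b \<le> n" and q: "q permutes {..<n}" for b q
  proof -
    have qn: "q n = n" using q by (simp add: permutes_not_in)
    have "permutation q" using q by (auto intro: permutation_permutes[THEN iffD2])
    then have sgn: "sign (transpose n b \<circ> q) = (if b = n then sign q else - sign q)"
      by (simp add: sign_compose sign_swap_id permutation_swap_id)
    have "(\<Prod>s<n. m ((K @ [i]) ! transpose n b (q s)) ((K @ [j]) ! s)) =
        (\<Prod>s<n. m ((if b = n then K else K[b := i]) ! q s) (K ! s))"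
    proof (rule prod.cong[OF refl])
      fix s assume "s \<in> {..<n}"
      then have "s < n" "q s < n" using permutes_lessThan_iff[OF q] by auto
      then have "(K @ [i]) ! transpose n b (q s) = (if b = n then K else K[b := i]) ! q s"
        using b assms by (auto simp: transpose_def nth_append)
      then show "m ((K @ [i]) ! transpose n b (q s)) ((K @ [j]) ! s) =
          m ((if b = n then K else K[b := i]) ! q s) (K ! s)"
        using \<open>s < n\<close> assms by (simp add: nth_append)
    qed
    then show ?thesis
      using b assms by (auto simp: sgn qn nth_append mult.assoc)
  qed
  have "minor m (Suc n) (K @ [i]) (K @ [j]) = (\<Sum>b\<in>insert n {..<n}. \<Sum>q | q permutes {..<n}. ?f (transpose n b \<circ> q))"
    unfolding minor_def lessThan_Suc by (subst sum_over_permutations_insert) auto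
  also have "\<dots> = (\<Sum>b\<in>insert n {..<n}. \<Sum>q | q permutes {..<n}.
      (if b = n then of_int (sign q) * (\<Prod>s<n. m (K ! q s) (K ! s)) * m i j
       else - (of_int (sign q) * (\<Prod>s<n. m (K[b := i] ! q s) (K ! s)) * m (K ! b) j)))"
    by (intro sum.cong refl f) auto
  also have "\<dots> = minor m n K K * m i j - (\<Sum>b<n. minor m n (K[b := i]) K * m (K ! b) j)"
    by (simp add: minor_def sum_negf sum_distrib_right)
  finally show ?thesis .
qed

section \<open>Traced determinants and their recursion\<close>

definition traced_minor :: "('v \<Rightarrow> 'v \<Rightarrow> 'a::comm_ring_1) \<Rightarrow> 'v set \<Rightarrow> nat \<Rightarrow> 'v \<Rightarrow> 'v \<Rightarrow> 'a" where
  "traced_minor m B n i j = (\<Sum>K\<in>multi_indices B n. minor m (Suc n) (K @ [i]) (K @ [j]))"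

text \<open>For \<open>m\<close> the matrix of X, this is n! times \<sigma>_n(X), and
  \<open>traced_minor m B n\<close> is the matrix of (n + 1)! times X^[n+1]: there \<open>n\<close>
  counts the traced positions. Leaving out the factorials keeps the recursion free of
  division.\<close>

definition principal_minors :: "('v \<Rightarrow> 'v \<Rightarrow> 'a::comm_ring_1) \<Rightarrow> 'v set \<Rightarrow> nat \<Rightarrow> 'a" where
  "principal_minors m B n = (\<Sum>K\<in>multi_indices B n. minor m n K K)"

lemma sum_minor_replaced_entry:
  assumes "b \<le> n" and i: "i \<in> B"
  shows "(\<Sum>K\<in>multi_indices B (Suc n). minor m (Suc n) (K[b := i]) K * m (K ! b) j) =
    (\<Sum>l\<in>B. traced_minor m B n i l * m l j)"
proof -
  \<comment> \<open>The summand is invariant under exchanging the positions \<open>b\<close> and \<open>n\<close>, so \<open>b = n\<close> may be assumed.\<close>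
  let ?q = "transpose b n"
  let ?swap = "\<lambda>K. K[b := K ! n, n := K ! b]"
  have q: "?q permutes {..<Suc n}"
    using assms by (intro permutes_swap_id) auto
  have "(\<Sum>K\<in>multi_indices B (Suc n). minor m (Suc n) (K[b := i]) K * m (K ! b) j) =
    (\<Sum>K\<in>multi_indices B (Suc n). minor m (Suc n) (K[n := i]) K * m (K ! n) j)"
  proof (rule sum.reindex_bij_witness[where i = ?swap and j = ?swap])
    fix K assume "K \<in> multi_indices B (Suc n)"
    then have K: "length K = Suc n" "set K \<subseteq> B" by (auto simp: multi_indices_def)
    show "?swap (?swap K) = K" "?swap (?swap K) = K"
      using assms K by (auto simp: list_eq_iff_nth_eq nth_list_update)
    show "?swap K \<in> multi_indices B (Suc n)" "?swap K \<in> multi_indices B (Suc n)"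
      using assms K by (auto simp: multi_indices_def subset_iff set_swap)
    have "minor m (Suc n) ((?swap K)[n := i]) (?swap K) = minor m (Suc n) (K[b := i]) K"
      by (rule minor_permute[OF q]) (use assms K in \<open>auto simp: nth_list_update transpose_def\<close>)
    then show "minor m (Suc n) ((?swap K)[n := i]) (?swap K) * m (?swap K ! n) j =
        minor m (Suc n) (K[b := i]) K * m (K ! b) j"
      using assms K by (simp add: nth_list_update)
  qed
  \<comment> \<open>Writing \<open>K\<close> as \<open>K' @ [l]\<close>, the replacement at position
    \<open>n\<close> gives rows \<open>K' @ [i]\<close> against columns \<open>K' @ [l]\<close>;
    summing over \<open>K'\<close> is the trace.\<close>
  also have "\<dots> = (\<Sum>l\<in>B. traced_minor m B n i l * m l j)"
    unfolding sum_multi_indices_Suc traced_minor_def sum_distrib_right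
    by (intro sum.cong refl) (auto simp: multi_indices_def list_update_append nth_append)
  finally show ?thesis .
qed

lemma traced_minor_0: "traced_minor m B 0 i j = m i j"
  by (simp add: traced_minor_def minor_def lessThan_Suc)

text \<open>After summation over \<open>K\<close>, each of the n + 1 off-diagonal terms of the
  Laplace expansion gives the same matrix product, whence the factor \<open>Suc n\<close>.\<close>

lemma traced_minor_Suc:
  assumes "i \<in> B"
  shows "traced_minor m B (Suc n) i j =
    principal_minors m B (Suc n) * m i j - of_nat (Suc n) * (\<Sum>l\<in>B. traced_minor m B n i l * m l j)"
proof -
  have "traced_minor m B (Suc n) i j =
    (\<Sum>K\<in>multi_indices B (Suc n). minor m (Suc n) K K * m i j
      - (\<Sum>b<Suc n. minor m (Suc n) (K[b := i]) K * m (K ! b) j))"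
    unfolding traced_minor_def
    by (intro sum.cong refl minor_expand_last_column) (auto simp: multi_indices_def)
  also have "\<dots> = principal_minors m B (Suc n) * m i j -
    (\<Sum>b<Suc n. \<Sum>K\<in>multi_indices B (Suc n). minor m (Suc n) (K[b := i]) K * m (K ! b) j)"
    by (subst sum.swap[of _ "multi_indices B (Suc n)" "{..<Suc n}"])
       (simp add: sum_subtractf principal_minors_def sum_distrib_right)
  also have "(\<Sum>b<Suc n. \<Sum>K\<in>multi_indices B (Suc n). minor m (Suc n) (K[b := i]) K * m (K ! b) j) =
    (\<Sum>b<Suc n. \<Sum>l\<in>B. traced_minor m B n i l * m l j)"
    by (intro sum.cong refl sum_minor_replaced_entry) (use assms in auto)
  finally show ?thesis by (simp add: algebra_simps)
qed

section \<open>Matrix elements of the exterior power as determinants\<close>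

lemma exterior_power_op_eq_minor:
  assumes "finite B" and I: "I \<in> multi_indices B k"
  shows "exterior_power_op scale B X k I J = minor (matrix_element scale B X) k I J / fact k"
proof -
  let ?m = "matrix_element scale B X"
  let ?T = "\<lambda>K. \<Prod>s<k. ?m (K ! s) (J ! s)"
  have len: "length I = k" "set I \<subseteq> B" using I by (auto simp: multi_indices_def)
  \<comment> \<open>For fixed \<open>p\<close> the Kronecker deltas of the antisymmetrizer select
    exactly one \<open>K\<close>, namely \<open>I\<close> permuted by \<open>inv p\<close>.\<close>
  have delta: "(\<Sum>K\<in>multi_indices B k. (\<Prod>s<k. if I ! s = K ! p s then 1 else 0) * ?T K) =
      (\<Prod>s<k. ?m (I ! inv p s) (J ! s))"
    if p: "p permutes {..<k}" for p
  proof -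
    let ?K = "permute_list (inv p) I"
    have ip: "inv p permutes {..<k}" by (rule permutes_inv[OF p])
    have K: "?K \<in> multi_indices B k"
      using len ip by (simp add: multi_indices_def)
    have nth: "?K ! s = I ! inv p s" if "s < k" for s
      using ip len that by (simp add: permute_list_nth)
    have "(\<Prod>s<k. if I ! s = K ! p s then 1 else 0) = (if K = ?K then 1 else (0::'b))"
      if K': "K \<in> multi_indices B k" for K
    proof -
      have "(\<forall>s<k. I ! s = K ! p s) \<longleftrightarrow> K = ?K"
      proof
        assume *: "\<forall>s<k. I ! s = K ! p s"
        show "K = ?K"
        proof (rule nth_equalityI)
          show "length K = length ?K" using K' len by (simp add: multi_indices_def)
          fix s assume "s < length K"
          then have "s < k" using K' by (simp add: multi_indices_def)
          then show "K ! s = ?K ! s"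
            using * nth permutes_lessThan_iff[OF ip] by (simp add: permutes_inverses[OF p])
        qed
      next
        assume "K = ?K"
        then show "\<forall>s<k. I ! s = K ! p s"
          using nth permutes_lessThan_iff[OF p] by (simp add: permutes_inverses[OF p])
      qed
      then show ?thesis by (auto simp: prod_zero_iff)
    qed
    then have "(\<Sum>K\<in>multi_indices B k. (\<Prod>s<k. if I ! s = K ! p s then 1 else 0) * ?T K) =
       (\<Sum>K\<in>multi_indices B k. if K = ?K then ?T K else 0)"
      by (intro sum.cong) auto
    also have "\<dots> = ?T ?K" using K assms(1) by (simp add: sum.delta)
    finally show ?thesis using nth by simp
  qed
  have "exterior_power_op scale B X k I J = 1 / fact k * (\<Sum>K\<in>multi_indices B k.
      \<Sum>p | p permutes {..<k}. of_int (sign p) * ((\<Prod>s<k. if I ! s = K ! p s then 1 else 0) * ?T K))"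
    unfolding exterior_power_op_def tensor_comp_def antisymmetrizer_def tensor_power_op_def
    by (simp add: sum_distrib_left sum_distrib_right mult.assoc)
  also have "\<dots> = 1 / fact k * (\<Sum>p | p permutes {..<k}. of_int (sign p) * (\<Prod>s<k. ?m (I ! inv p s) (J ! s)))"
    by (subst sum.swap) (simp add: sum_distrib_left[symmetric] delta)
  \<comment> \<open>Inversion permutes the summation range and preserves signs, so
    \<open>inv p\<close> may be replaced by \<open>p\<close>.\<close>
  also have "(\<Sum>p | p permutes {..<k}. of_int (sign p) * (\<Prod>s<k. ?m (I ! inv p s) (J ! s))) = minor ?m k I J"
    unfolding minor_def
    by (rule sum.reindex_bij_witness[where i = inv and j = inv])
       (auto simp: permutes_inv inv_inv_eq permutes_bij sign_inverse
          dest: permutes_imp_permutation[OF finite_lessThan])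
  finally show ?thesis by simp
qed

section \<open>Trace over the image of the antisymmetrizer\<close>

global_interpretation tensors: vector_space "tensor_scale :: 'a::field \<Rightarrow> ('v, 'a) tensor \<Rightarrow> ('v, 'a) tensor"
  by standard (auto simp: tensor_scale_def fun_eq_iff algebra_simps)

definition unit_tensor :: "'v list \<Rightarrow> ('v, 'a::zero_neq_one) tensor" where
  "unit_tensor J = (\<lambda>I. if I = J then 1 else 0)"

lemma sum_fun_apply: "(\<Sum>x\<in>A. f x) I = (\<Sum>x\<in>A. f x I)" for f :: "'b \<Rightarrow> ('v, 'a::comm_ring_1) tensor"
  by (induction A rule: infinite_finite_induct) auto

lemma tensor_apply_comp:
  assumes "finite B"
  shows "tensor_apply B k (tensor_comp B k M N) t = tensor_apply B k M (tensor_apply B k N t)"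
proof
  fix I
  have "(\<Sum>J\<in>multi_indices B k. (\<Sum>K\<in>multi_indices B k. M I K * N K J) * t J) =
      (\<Sum>K\<in>multi_indices B k. M I K * (\<Sum>J\<in>multi_indices B k. N K J * t J))"
    unfolding sum_distrib_left sum_distrib_right mult.assoc by (rule sum.swap)
  then show "tensor_apply B k (tensor_comp B k M N) t I = tensor_apply B k M (tensor_apply B k N t) I"
    by (simp add: tensor_apply_def tensor_comp_def)
qed

lemma tensor_expansion:
  fixes t :: "('v, 'a::comm_ring_1) tensor"
  assumes "finite B" "t \<in> tensor_space B k"
  shows "t = (\<Sum>J\<in>multi_indices B k. tensor_scale (t J) (unit_tensor J))"
proof
  fix I
  have "tensor_scale (t J) (unit_tensor J) I = (if I = J then t J else 0)" for J
    by (simp add: tensor_scale_def unit_tensor_def)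
  then show "t I = (\<Sum>J\<in>multi_indices B k. tensor_scale (t J) (unit_tensor J)) I"
    using assms by (simp add: sum_fun_apply tensor_space_def)
qed

lemma tensor_apply_in_tensor_space [simp]: "tensor_apply B k M t \<in> tensor_space B k"
  by (simp add: tensor_apply_def tensor_space_def)

lemma unit_tensor_in_tensor_space: "J \<in> multi_indices B k \<Longrightarrow> unit_tensor J \<in> tensor_space B k"
  by (auto simp: tensor_space_def unit_tensor_def)

lemma subspace_tensor_space: "tensors.subspace (tensor_space B k)"
  by (auto simp: tensors.subspace_def tensor_space_def tensor_scale_def)

lemma linear_tensor_apply: "Vector_Spaces.linear tensor_scale tensor_scale (tensor_apply B k M)"
  by unfold_locales
     (auto simp: tensor_apply_def tensor_scale_def fun_eq_iff sum_distrib_left sum.distrib distrib_left mult.left_commute)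

text \<open>The matrix \<open>M\<close> factors through its image as \<open>M = C R\<close>, where
  the basis vectors are the columns of \<open>C\<close> and \<open>R\<close> gives the coordinates
  of the images of unit tensors. Then cyclicity of the trace gives tr(R N C) = tr(N C R) = tr(N M) =
  tr(M N).\<close>

lemma trace_on_image_tensor_comp:
  fixes M N :: "('v, 'a::field) tensor_op"
  assumes B: "finite B"
  shows "trace_on tensor_scale (tensor_apply B k M ` tensor_space B k) (tensor_apply B k (tensor_comp B k M N)) =
    (\<Sum>J\<in>multi_indices B k. tensor_comp B k M N J J)"
proof -
  let ?A = "tensor_apply B k M" and ?MI = "multi_indices B k"
  let ?W = "?A ` tensor_space B k"
  interpret A: Vector_Spaces.linear tensor_scale tensor_scale ?A by (rule linear_tensor_apply)
  have W: "tensors.subspace ?W"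
    by (rule A.subspace_image[OF subspace_tensor_space])
  \<comment> \<open>This is the very basis chosen inside \<open>trace_on\<close>; the existence of
    some basis \<open>C0\<close> gives \<open>C\<close> its defining properties.\<close>
  define C where "C = (SOME C. \<not> tensors.dependent C \<and> tensors.span C = ?W)"
  obtain C0 where "C0 \<subseteq> ?W" "tensors.independent C0" "?W \<subseteq> tensors.span C0"
    by (rule tensors.basis_exists[of ?W]) auto
  moreover have "tensors.span C0 \<subseteq> ?W"
    using \<open>C0 \<subseteq> ?W\<close> W by (rule tensors.span_minimal)
  ultimately have "\<not> tensors.dependent C0 \<and> tensors.span C0 = ?W" by auto
  then have "\<not> tensors.dependent C \<and> tensors.span C = ?W"
    unfolding C_def by (rule someI)
  then have indep: "tensors.independent C" and span: "tensors.span C = ?W" by auto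
  have "C \<subseteq> ?W" using span tensors.span_superset by blast
  then have CT: "C \<subseteq> tensor_space B k" by auto
  \<comment> \<open>\<open>C\<close> must be shown finite, since sums over an infinite set default
    to 0; it is an independent set in the span of finitely many unit tensors.\<close>
  have "C \<subseteq> tensors.span (unit_tensor ` ?MI)"
  proof
    fix c assume "c \<in> C"
    then have "c = (\<Sum>J\<in>?MI. tensor_scale (c J) (unit_tensor J))"
      using CT by (intro tensor_expansion[OF B]) auto
    also have "\<dots> \<in> tensors.span (unit_tensor ` ?MI)"
      by (intro tensors.span_sum tensors.span_scale tensors.span_base) auto
    finally show "c \<in> tensors.span (unit_tensor ` ?MI)" .
  qed
  then have fin: "finite C"
    using tensors.independent_span_bound[OF finite_imageI[OF finite_multi_indices[OF B]] indep]
    by simp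
  let ?r = "tensors.representation C"
  have AE: "?A (unit_tensor J) \<in> tensors.span C" if "J \<in> ?MI" for J
    unfolding span by (intro imageI unit_tensor_in_tensor_space that)
  \<comment> \<open>The coordinates of \<open>?A u\<close> are \<open>R\<close> applied to
    \<open>u\<close>.\<close>
  have rep: "?r (?A u) c = (\<Sum>J\<in>?MI. u J * ?r (?A (unit_tensor J)) c)"
    if u: "u \<in> tensor_space B k" for u c
  proof -
    have "?A u = (\<Sum>J\<in>?MI. tensor_scale (u J) (?A (unit_tensor J)))"
      by (subst tensor_expansion[OF B u]) (simp add: A.sum A.scale)
    then show ?thesis
      by (simp add: tensors.representation_sum[OF indep] tensors.representation_scale[OF indep]
          AE tensors.span_scale)
  qed
  \<comment> \<open>This is the factorization \<open>M = C R\<close>, entry by entry.\<close>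
  have entry: "(\<Sum>c\<in>C. ?r (?A (unit_tensor J)) c * c K) = M K J" if "J \<in> ?MI" "K \<in> ?MI" for J K
  proof -
    have "(\<Sum>c\<in>C. tensor_scale (?r (?A (unit_tensor J)) c) c) = ?A (unit_tensor J)"
      by (rule tensors.sum_representation_eq[OF indep AE[OF that(1)] fin]) simp
    then have "(\<Sum>c\<in>C. tensor_scale (?r (?A (unit_tensor J)) c) c) K = ?A (unit_tensor J) K"
      by simp
    moreover have "(\<Sum>L\<in>?MI. M K L * unit_tensor J L) = (\<Sum>L\<in>?MI. if L = J then M K L else 0)"
      by (intro sum.cong) (simp_all add: unit_tensor_def)
    ultimately show ?thesis
      using that B by (simp add: sum_fun_apply tensor_scale_def tensor_apply_def)
  qed
  have "trace_on tensor_scale ?W (tensor_apply B k (tensor_comp B k M N)) =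
      (\<Sum>c\<in>C. ?r (?A (tensor_apply B k N c)) c)"
    by (simp add: trace_on_def C_def[symmetric] tensor_apply_comp[OF B])
  also have "\<dots> = (\<Sum>c\<in>C. \<Sum>J\<in>?MI. \<Sum>K\<in>?MI. N J K * (?r (?A (unit_tensor J)) c * c K))"
    unfolding rep[OF tensor_apply_in_tensor_space]
    by (intro sum.cong refl) (simp add: tensor_apply_def[of B k N] sum_distrib_left sum_distrib_right mult_ac)
  also have "\<dots> = (\<Sum>J\<in>?MI. \<Sum>K\<in>?MI. \<Sum>c\<in>C. N J K * (?r (?A (unit_tensor J)) c * c K))"
    by (subst sum.swap, rule sum.cong[OF refl], rule sum.swap)
  also have "\<dots> = (\<Sum>J\<in>?MI. \<Sum>K\<in>?MI. N J K * M K J)"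
    by (simp add: sum_distrib_left[symmetric] entry)
  also have "\<dots> = (\<Sum>J\<in>?MI. tensor_comp B k M N J J)"
    unfolding tensor_comp_def by (subst sum.swap) (simp add: mult.commute)
  finally show ?thesis .
qed

lemma sigma_eq_principal_minors:
  assumes "finite B"
  shows "sigma scale B X j = principal_minors (matrix_element scale B X) B j / fact j"
proof (cases "j = 0")
  case True
  then show ?thesis by (simp add: sigma_def principal_minors_def minor_def)
next
  case False
  then have "sigma scale B X j = (\<Sum>J\<in>multi_indices B j. exterior_power_op scale B X j J J)"
    by (simp add: sigma_def exterior_space_def exterior_power_op_def trace_on_image_tensor_comp[OF assms])
  then show ?thesis
    by (simp add: exterior_power_op_eq_minor[OF assms] principal_minors_def sum_divide_distrib)
qed

section \<open>The recursion for X^[k] and its solution\<close>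

lemma Suc_bracket_power:
  fixes scale :: "'a::field_char_0 \<Rightarrow> 'v::ab_group_add \<Rightarrow> 'v"
  assumes "finite_dimensional_vector_space scale B"
  shows "scale (of_nat (Suc n)) (bracket_power scale B X (Suc n) v) =
    (\<Sum>i\<in>B. scale (\<Sum>j\<in>B. traced_minor (matrix_element scale B X) B n i j / fact n
       * module.representation scale B v j) i)"
proof -
  interpret finite_dimensional_vector_space scale B by (rule assms)
  let ?m = "matrix_element scale B X"
  have "(\<Sum>K\<in>multi_indices B n. exterior_power_op scale B X (Suc n) (K @ [i]) (K @ [j])) =
      traced_minor ?m B n i j / fact (Suc n)" if "i \<in> B" for i j
    unfolding traced_minor_def sum_divide_distrib
    by (intro sum.cong refl exterior_power_op_eq_minor finite_Basis)
       (use that in \<open>auto simp: multi_indices_def\<close>)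
  then have "scale (of_nat (Suc n)) (bracket_power scale B X (Suc n) v) =
     (\<Sum>i\<in>B. scale (\<Sum>j\<in>B. of_nat (Suc n) * (traced_minor ?m B n i j / fact (Suc n) * representation B v j)) i)"
    by (simp add: bracket_power_def partial_trace_def scale_sum_right sum_distrib_left
        del: of_nat_Suc fact_Suc)
  \<comment> \<open>The factor k = n + 1 turns 1/(n + 1)! into 1/n!, the normalization of
    \<sigma>_n(X).\<close>
  moreover have "of_nat (Suc n) * (x / fact (Suc n) * y) = x / fact n * y" for x y :: 'a
    unfolding fact_Suc of_nat_mult by (simp del: of_nat_Suc)
  ultimately show ?thesis by (simp del: of_nat_Suc fact_Suc)
qed

text \<open>This is \<open>traced_minor_Suc\<close> divided by n!. Multiplication by the matrix of X
  on the right becomes evaluation at \<open>X v\<close>.\<close>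

lemma Suc_bracket_power_rec:
  fixes scale :: "'a::field_char_0 \<Rightarrow> 'v::ab_group_add \<Rightarrow> 'v"
  assumes fd: "finite_dimensional_vector_space scale B"
    and X: "Vector_Spaces.linear scale scale X"
  shows "scale (of_nat (Suc n)) (bracket_power scale B X (Suc n) v) =
    scale (sigma scale B X n) (X v) - scale (of_nat n) (bracket_power scale B X n (X v))"
proof -
  interpret finite_dimensional_vector_space scale B by (rule fd)
  interpret X: Vector_Spaces.linear scale scale X by (rule X)
  let ?m = "matrix_element scale B X" and ?r = "representation B"
  have in_span: "u \<in> span B" for u by (simp add: span_Basis)
  have expand: "(\<Sum>b\<in>B. scale (?r u b) b) = u" for u
    by (rule sum_representation_eq[OF independent_Basis in_span finite_Basis]) simp
  have rX: "?r (X u) i = (\<Sum>j\<in>B. ?m i j * ?r u j)" for u i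
  proof -
    have "X u = (\<Sum>j\<in>B. scale (?r u j) (X j))"
      by (subst expand[of u, symmetric]) (simp add: X.sum X.scale)
    then show ?thesis
      by (simp add: representation_sum[OF independent_Basis] representation_scale[OF independent_Basis]
          in_span matrix_element_def mult.commute)
  qed
  have mX: "(\<Sum>i\<in>B. scale (c * (\<Sum>j\<in>B. ?m i j * ?r v j)) i) = scale c (X v)" for c
    by (simp add: rX[symmetric] expand scale_sum_right[symmetric] flip: scale_scale)
  show ?thesis
  proof (cases n)
    \<comment> \<open>Here \<sigma>_0(X) = 1 and X^[1] = X; the meaningless value of
      \<open>bracket_power\<close> at 0 is multiplied by 0.\<close>
    case 0
    show ?thesis
      using mX[of 1] Suc_bracket_power[OF fd, of 0 X v] by (simp add: 0 traced_minor_0 sigma_def)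
  next
    case (Suc l)
    have "(\<Sum>j\<in>B. traced_minor ?m B n i j / fact n * ?r v j) =
        sigma scale B X n * (\<Sum>j\<in>B. ?m i j * ?r v j)
        - (\<Sum>j\<in>B. traced_minor ?m B l i j / fact l * ?r (X v) j)" if "i \<in> B" for i
    proof -
      have "traced_minor ?m B n i j / fact n * ?r v j =
          sigma scale B X n * (?m i j * ?r v j)
          - (\<Sum>q\<in>B. traced_minor ?m B l i q / fact l * (?m q j * ?r v j))" for j
      proof -
        \<comment> \<open>The coefficient \<open>Suc l\<close> of the recursion reduces 1/(l + 1)!
          to 1/l!, as \<open>Suc_bracket_power\<close> requires for \<open>l\<close>.\<close>
        have "of_nat (Suc l) * x / fact (Suc l) = x / fact l" for x :: 'a
          unfolding fact_Suc of_nat_mult by (simp del: of_nat_Suc)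
        then show ?thesis
          unfolding Suc traced_minor_Suc[OF that] sigma_eq_principal_minors[OF finite_Basis]
          by (simp add: diff_divide_distrib left_diff_distrib sum_distrib_right sum_divide_distrib mult.assoc
              del: of_nat_Suc fact_Suc)
      qed
      then have "(\<Sum>j\<in>B. traced_minor ?m B n i j / fact n * ?r v j) =
          sigma scale B X n * (\<Sum>j\<in>B. ?m i j * ?r v j)
          - (\<Sum>j\<in>B. \<Sum>q\<in>B. traced_minor ?m B l i q / fact l * (?m q j * ?r v j))"
        by (simp add: sum_subtractf sum_distrib_left)
      also have "(\<Sum>j\<in>B. \<Sum>q\<in>B. traced_minor ?m B l i q / fact l * (?m q j * ?r v j)) =
          (\<Sum>q\<in>B. traced_minor ?m B l i q / fact l * ?r (X v) q)"
        by (subst sum.swap) (simp add: rX sum_distrib_left)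
      finally show ?thesis .
    qed
    then show ?thesis
      unfolding Suc_bracket_power[OF fd] mX[symmetric] Suc
      by (simp add: scale_left_diff_distrib sum_subtractf del: of_nat_Suc fact_Suc)
  qed
qed

theorem mainTheorem1:
  fixes scale :: "'a::field_char_0 \<Rightarrow> 'v::ab_group_add \<Rightarrow> 'v"
    and B :: "'v set"
    and X :: "'v \<Rightarrow> 'v"
    and k :: nat
  assumes "finite_dimensional_vector_space scale B"
    and "Vector_Spaces.linear scale scale X"
    and "k \<ge> 1"
  shows "(\<lambda>v. scale (of_nat k) (bracket_power scale B X k v)) =
         (\<lambda>v. - (\<Sum>j = 0..k - 1. scale (sigma scale B X j) (((\<lambda>u. - X u) ^^ (k - j)) v)))"
proof
  fix v
  interpret finite_dimensional_vector_space scale B by (rule assms(1))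
  interpret X: Vector_Spaces.linear scale scale X by (rule assms(2))
  let ?N = "\<lambda>u. - X u"
  have neg: "(?N ^^ n) (- u) = - (?N ^^ n) u" for n u
    by (induction n) (simp_all only: funpow.simps o_apply id_apply X.neg)
  have shift: "(?N ^^ n) (X u) = - (?N ^^ Suc n) u" for n u
    using neg[of n "X u"] by (simp add: funpow_Suc_right del: funpow.simps)
  \<comment> \<open>Starting at n = 0 makes both sides of the base case 0. The vector stays
    arbitrary because the recursion calls the induction hypothesis at \<open>X v\<close>.\<close>
  have "scale (of_nat n) (bracket_power scale B X n v) =
      - (\<Sum>j<n. scale (sigma scale B X j) ((?N ^^ (n - j)) v))" for n
  proof (induction n arbitrary: v)
    case 0
    show ?case by simp
  next
    case (Suc n)
    \<comment> \<open>Evaluation at \<open>X v\<close> raises each exponent of -X by one at the cost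
      of a sign; the remaining term \<sigma>_n(X) X of the recursion is the new summand j =
      n.\<close>
    have "(\<Sum>j<n. scale (sigma scale B X j) ((?N ^^ (n - j)) (X v))) =
        - (\<Sum>j<n. scale (sigma scale B X j) ((?N ^^ (Suc n - j)) v))"
      unfolding shift sum_negf[symmetric]
      by (intro sum.cong) (auto simp: Suc_diff_le simp del: funpow.simps)
    then show ?case
      unfolding Suc_bracket_power_rec[OF assms(1,2)] Suc.IH by simp
  qed
  moreover have "{0..k - 1} = {..<k}" using assms(3) by auto
  ultimately show "scale (of_nat k) (bracket_power scale B X k v) =
      - (\<Sum>j = 0..k - 1. scale (sigma scale B X j) ((?N ^^ (k - j)) v))" by simp
qed

end
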